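(* Let $N \geq 2$ be an integer and let $|\psi\rangle, |\phi\rangle \in (\mathbb{C}^2)^{\otimes N}$ be symmetric $N$-qubit states. Suppose there exist invertible linear operators $A_1, \ldots, A_N : \mathbb{C}^2 \to \mathbb{C}^2$ such that $$|\phi\rangle = (A_1 \otimes \cdots \otimes A_N)\,|\psi\rangle$$ and such that this invertible local operation is nonsymmetric, i.e. there are indices $i, j \in \{1,\ldots,N\}$ for which $A_i$ and $A_j$ are not proportional to each other. Then $|\psi\rangle$ and $|\phi\rangle$ both belong to the separable class, or both belong to the W class, or both belong to the GHZ class.
   Context: An $N$-qubit state is a nonzero vector of $(\mathbb{C}^2)^{\otimes N}$ (not required to be normalized). The symmetric group on $\{1,\ldots,N\}$ acts linearly on $(\mathbb{C}^2)^{\otimes N}$ by permuting the tensor factors; a state is symmetric if it is fixed by every permutation. Two $N$-qubit states $|\alpha\rangle, |\beta\rangle$ are SLOCC equivalent (belong to the same class) if $|\alpha\rangle = (B_1 \otimes \cdots \otimes B_N)|\beta\rangle$ for some invertible linear operators $B_1,\ldots,B_N$ on $\mathbb{C}^2$; such an operator $B_1 \otimes \cdots \otimes B_N$ is called an invertible local operation. Let $\{|0\rangle, |1\rangle\}$ be the standard basis of $\mathbb{C}^2$, and write $|x_1 \ldots x_N\rangle = |x_1\rangle \otimes \cdots \otimes |x_N\rangle$. The separable class is the set of states SLOCC equivalent to $|0\ldots0\rangle$. The W class is the set of states SLOCC equivalent to $$|\mathrm{W}_N\rangle = \tfrac{1}{\sqrt{N}}\left(|10\ldots0\rangle + |010\ldots0\rangle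 + \cdots + |0\ldots01\rangle\right).$$ The GHZ class is the set of states SLOCC equivalent to $$|\mathrm{GHZ}_N\rangle = \tfrac{1}{\sqrt{2}}\left(|0\ldots0\rangle + |1\ldots1\rangle\right).$$ *)

theory Defs
  imports "HOL-Analysis.Analysis"
begin

(* The N tensor factors are indexed by a finite type 'n with CARD('n) = N.  An element of the
   N-fold tensor power of C^2 is given by its coordinates with respect to the computational
   basis, whose elements are labelled by the bit strings 'n => 2; the numeral type 2 has
   exactly the elements 0 and 1. *)

type_synonym qubit = "complex ^ 2"
type_synonym 'n qubits = "complex ^ ('n \<Rightarrow> 2)"

definition tensor_vec :: "('n::finite \<Rightarrow> qubit) \<Rightarrow> 'n qubits" where
  "tensor_vec v = (\<chi> x. \<Prod>i\<in>UNIV. v i $ x i)"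

definition tensor_op :: "('n::finite \<Rightarrow> complex ^ 2 ^ 2) \<Rightarrow> complex ^ ('n \<Rightarrow> 2) ^ ('n \<Rightarrow> 2)" where
  "tensor_op A = (\<chi> x y. \<Prod>i\<in>UNIV. A i $ x i $ y i)"

lemma tensor_op_tensor_vec:
  "tensor_op A *v tensor_vec v = tensor_vec (\<lambda>i. A i *v v i)"
proof -
  have "(\<Sum>y\<in>UNIV. (\<Prod>i\<in>UNIV. A i $ x i $ y i) * (\<Prod>i\<in>UNIV. v i $ y i))
      = (\<Prod>i\<in>UNIV. \<Sum>b\<in>UNIV. A i $ x i $ b * v i $ b)" for x :: "'a \<Rightarrow> 2"
    by (subst prod_sum_PiE) (simp_all add: PiE_UNIV_domain flip: prod.distrib)
  then show ?thesis
    by (simp add: vec_eq_iff matrix_vector_mult_def tensor_op_def tensor_vec_def)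
qed

definition permute_factors :: "('n::finite \<Rightarrow> 'n) \<Rightarrow> 'n qubits \<Rightarrow> 'n qubits" where
  "permute_factors \<sigma> \<psi> = (\<chi> x. \<psi> $ (x \<circ> \<sigma>))"

lemma permute_factors_tensor_vec:
  assumes "\<sigma> permutes UNIV"
  shows "permute_factors \<sigma> (tensor_vec v) = tensor_vec (v \<circ> inv \<sigma>)"
proof -
  have "(\<Prod>i\<in>UNIV. v i $ x (\<sigma> i)) = (\<Prod>i\<in>UNIV. v (inv \<sigma> i) $ x i)" for x :: "'a \<Rightarrow> 2"
    using prod.permute[OF assms, of "\<lambda>i. v (inv \<sigma> i) $ x i"] permutes_inverses(2)[OF assms]
    by (simp add: o_def)
  then show ?thesis
    by (simp add: vec_eq_iff permute_factors_def tensor_vec_def)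
qed

definition is_state :: "'n::finite qubits \<Rightarrow> bool" where
  "is_state \<psi> \<longleftrightarrow> \<psi> \<noteq> 0"

definition symmetric_state :: "'n::finite qubits \<Rightarrow> bool" where
  "symmetric_state \<psi> \<longleftrightarrow> is_state \<psi> \<and> (\<forall>\<sigma>. \<sigma> permutes UNIV \<longrightarrow> permute_factors \<sigma> \<psi> = \<psi>)"

definition slocc_equivalent :: "'n::finite qubits \<Rightarrow> 'n qubits \<Rightarrow> bool" where
  "slocc_equivalent \<alpha> \<beta> \<longleftrightarrow> (\<exists>B. (\<forall>i. invertible (B i)) \<and> \<alpha> = tensor_op B *v \<beta>)"

definition slocc_class :: "'n::finite qubits \<Rightarrow> 'n qubits set" where
  "slocc_class \<beta> = {\<alpha>. is_state \<alpha> \<and> slocc_equivalent \<alpha> \<beta>}"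

definition ket :: "('n::finite \<Rightarrow> 2) \<Rightarrow> 'n qubits" where
  "ket x = tensor_vec (\<lambda>i. axis (x i) 1)"

definition W_state :: "'n::finite qubits" where
  "W_state = complex_of_real (1 / sqrt (real CARD('n))) *s
     (\<Sum>k\<in>UNIV. ket (\<lambda>i. if i = k then 1 else 0))"

definition GHZ_state :: "'n::finite qubits" where
  "GHZ_state = complex_of_real (1 / sqrt 2) *s (ket (\<lambda>_. 0) + ket (\<lambda>_. 1))"

definition separable_class :: "'n::finite qubits set" where
  "separable_class = slocc_class (ket (\<lambda>_. 0))"

definition W_class :: "'n::finite qubits set" where
  "W_class = slocc_class W_state"

definition GHZ_class :: "'n::finite qubits set" where
  "GHZ_class = slocc_class GHZ_state"

(* Only applied to invertible operators, for which the condition c ~= 0 is automatic. *)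
definition proportional :: "complex ^ 2 ^ 2 \<Rightarrow> complex ^ 2 ^ 2 \<Rightarrow> bool" where
  "proportional A B \<longleftrightarrow> (\<exists>c. c \<noteq> 0 \<and> A = (\<chi> r s. c * B $ r $ s))"

end

theory Submission imports Defs begin

text \<open>If \<open>A i\<close> and \<open>A j\<close> are not proportional, then exchanging the factors \<open>i\<close> and \<open>j\<close> in
  \<open>\<phi> = tensor_op A *v \<psi>\<close> shows that the nonscalar matrix \<open>C = (A j)\<^sup>-\<^sup>1 A i\<close> acts on \<open>\<psi>\<close> at site \<open>i\<close>
  as it does at site \<open>j\<close>, hence, by symmetry of \<open>\<psi>\<close>, in the same way at all sites.  Shifting \<open>C\<close> by
  an eigenvalue and passing to a Jordan basis, a diagonal \<open>C\<close> leaves only the strings \<open>0\<dots>0\<close> and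
  \<open>1\<dots>1\<close> (separable or GHZ), and a nilpotent one leaves only strings with at most one \<open>1\<close>
  (separable or W).\<close>

section \<open>Bits and two-by-two matrices\<close>

lemma two_bit: "(2::2) = 0" by simp

lemma bit_cases: "(b::2) = 0 \<or> b = 1"
  using exhaust_2[of b] by auto

lemma sum_bit: "(\<Sum>b\<in>(UNIV::2 set). f b) = f 0 + f 1"
  using sum_2[of f] by (simp add: two_bit add.commute)

lemma all_bit: "(\<forall>b::2. P b) \<longleftrightarrow> P 0 \<and> P 1"
  using bit_cases by metis

definition mat2 :: "complex \<Rightarrow> complex \<Rightarrow> complex \<Rightarrow> complex \<Rightarrow> complex ^ 2 ^ 2" where
  "mat2 a b c d = (\<chi> r s. if r = 0 then (if s = 0 then a else b) else (if s = 0 then c else d))"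

lemma mat2_nth [simp]:
  "mat2 a b c d $ 0 $ 0 = a" "mat2 a b c d $ 0 $ 1 = b"
  "mat2 a b c d $ 1 $ 0 = c" "mat2 a b c d $ 1 $ 1 = d"
  by (simp_all add: mat2_def)

lemma mat2_eta: "M = mat2 (M $ 0 $ 0) (M $ 0 $ 1) (M $ 1 $ 0) (M $ 1 $ 1)"
  by (simp add: vec_eq_iff all_bit)

lemma invertible_mat2: "invertible (mat2 a b c d) \<longleftrightarrow> a * d - b * c \<noteq> 0"
  by (simp add: invertible_det_nz det_2 two_bit algebra_simps)

lemma mat2_mult:
  "mat2 a b c d ** mat2 a' b' c' d' =
   mat2 (a * a' + b * c') (a * b' + b * d') (c * a' + d * c') (c * b' + d * d')"
  by (simp add: vec_eq_iff all_bit matrix_matrix_mult_def sum_bit)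

text \<open>With \<open>e\<close> a cyclic vector of \<open>C\<close>, \<open>\<mu>\<close> an eigenvalue, \<open>D = C - \<mu>\<close> and \<open>t\<close> the trace of \<open>D\<close>,
  Cayley--Hamilton gives \<open>D\<^sup>2 = t D\<close>; the basis is \<open>D e, D e - t e\<close> if \<open>t \<noteq> 0\<close>
  and \<open>D e, e\<close> if \<open>t = 0\<close>.\<close>

lemma nonscalar_normal_form:
  fixes C :: "complex ^ 2 ^ 2"
  assumes nonscalar: "\<And>c. C \<noteq> mat c"
  obtains \<mu> P J where "invertible P" "(C - mat \<mu>) ** P = P ** J"
    "(\<exists>t. t \<noteq> 0 \<and> J = mat2 t 0 0 0) \<or> J = mat2 0 1 0 0"
proof -
  obtain a b c d where C: "C = mat2 a b c d"
    using mat2_eta by blast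
  have "b \<noteq> 0 \<or> c \<noteq> 0 \<or> b = 0 \<and> c = 0 \<and> a \<noteq> d"
    using nonscalar[of a] by (auto simp: C vec_eq_iff all_bit mat_def)
  \<comment> \<open>The expression is the determinant with columns \<open>e = (p, q)\<close> and
    \<open>C e\<close>, so its being nonzero says that \<open>e\<close> is cyclic. One of the
    vectors (0,1), (1,0), (1,1) always works.\<close>
  then have "\<exists>p q. p * (c * p + d * q) - q * (a * p + b * q) \<noteq> 0"
  proof (elim disjE)
    assume "b \<noteq> 0" then show ?thesis by (intro exI[of _ 0] exI[of _ 1]) simp
  next
    assume "c \<noteq> 0" then show ?thesis by (intro exI[of _ 1] exI[of _ 0]) simp
  next
    assume "b = 0 \<and> c = 0 \<and> a \<noteq> d"
    then show ?thesis by (intro exI[of _ 1]) auto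
  qed
  then obtain p q where cyclic: "p * (c * p + d * q) - q * (a * p + b * q) \<noteq> 0" by blast
  \<comment> \<open>\<open>s\<close> is a square root of the discriminant of the characteristic
    polynomial, hence \<open>\<mu>\<close> is one of its roots; \<open>det0\<close> records that
    \<open>C - mat \<mu>\<close> is singular.\<close>
  define s where "s = csqrt ((a - d)\<^sup>2 + 4 * (b * c))"
  define \<mu> where "\<mu> = (a + d + s) / 2"
  define t where "t = a + d - 2 * \<mu>"
  have s: "s * s = (a - d) * (a - d) + 4 * (b * c)"
    using power2_csqrt[of "(a - d)\<^sup>2 + 4 * (b * c)"] by (simp add: s_def power2_eq_square)
  have det0: "(a - \<mu>) * (d - \<mu>) = b * c"
    using s by (simp add: \<mu>_def field_simps)
  \<comment> \<open>\<open>(f, g)\<close> is \<open>D e\<close>. Passing from \<open>C e\<close> to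
    \<open>D e\<close> subtracts a multiple of \<open>e\<close>, which leaves the determinant in
    \<open>cyclic\<close> unchanged.\<close>
  define f where "f = (a - \<mu>) * p + b * q"
  define g where "g = c * p + (d - \<mu>) * q"
  have fg: "p * g - q * f \<noteq> 0"
    using cyclic by (simp add: f_def g_def algebra_simps)
  have D: "C - mat \<mu> = mat2 (a - \<mu>) b c (d - \<mu>)"
    by (simp add: C vec_eq_iff all_bit mat_def)
  have Df: "(a - \<mu>) * f + b * g = t * f" "c * f + (d - \<mu>) * g = t * g"
    using det0 unfolding f_def g_def t_def by algebra+
  show ?thesis
  proof (cases "t = 0")
    case True
    show ?thesis
    proof (rule that)
      show "invertible (mat2 f p g q)"
        using fg by (simp add: invertible_mat2 algebra_simps)
      show "(C - mat \<mu>) ** mat2 f p g q = mat2 f p g q ** mat2 0 1 0 0"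
        unfolding D mat2_mult using Df True by (simp add: f_def[symmetric] g_def[symmetric])
    qed simp
  next
    case False
    show ?thesis
    proof (rule that)
      have "f * (g - t * q) - (f - t * p) * g = t * (p * g - q * f)"
        by algebra
      then show "invertible (mat2 f (f - t * p) g (g - t * q))"
        using fg False by (simp add: invertible_mat2)
      have "(a - \<mu>) * (f - t * p) + b * (g - t * q) = 0"
        "c * (f - t * p) + (d - \<mu>) * (g - t * q) = 0"
        using Df f_def g_def by algebra+
      then show "(C - mat \<mu>) ** mat2 f (f - t * p) g (g - t * q)
          = mat2 f (f - t * p) g (g - t * q) ** mat2 t 0 0 0"
        unfolding D mat2_mult using Df by (simp add: mult.commute)
    qed (use False in blast)
  qed
qed

section \<open>Composition of local operators and their behaviour under permutations\<close>

lemma invertible_mat_one: "invertible (mat 1)"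
  unfolding invertible_def by (rule exI[of _ "mat 1"]) simp

lemma tensor_op_mult:
  fixes A B :: "'n::finite \<Rightarrow> complex ^ 2 ^ 2"
  shows "tensor_op A ** tensor_op B = tensor_op (\<lambda>i. A i ** B i)"
proof -
  have "(\<Sum>y\<in>UNIV. (\<Prod>i\<in>UNIV. A i $ x i $ y i) * (\<Prod>i\<in>UNIV. B i $ y i $ z i))
      = (\<Prod>i\<in>UNIV. \<Sum>b\<in>UNIV. A i $ x i $ b * B i $ b $ z i)" for x z :: "'n \<Rightarrow> 2"
    by (subst prod_sum_PiE) (simp_all add: PiE_UNIV_domain flip: prod.distrib)
  then show ?thesis
    by (simp add: vec_eq_iff matrix_matrix_mult_def tensor_op_def)
qed

lemma tensor_op_mult_vec: "tensor_op A *v (tensor_op B *v \<psi>) = tensor_op (\<lambda>i. A i ** B i) *v \<psi>"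
  by (simp add: matrix_vector_mul_assoc tensor_op_mult)

lemma tensor_op_one: "tensor_op (\<lambda>_::'n::finite. mat 1) = mat 1"
proof -
  have "(\<Prod>i\<in>UNIV. if x i = y i then 1 else 0) = (if x = y then 1 else (0::complex))"
    for x y :: "'n \<Rightarrow> 2"
    by (auto simp: fun_eq_iff)
  then show ?thesis
    by (simp add: vec_eq_iff tensor_op_def mat_def)
qed

lemma permute_factors_tensor_op:
  assumes \<sigma>: "\<sigma> permutes UNIV"
  shows "permute_factors \<sigma> (tensor_op A *v \<psi>) = tensor_op (A \<circ> inv \<sigma>) *v permute_factors \<sigma> \<psi>"
proof -
  have bij: "bij (\<lambda>z. z \<circ> \<sigma> :: _ \<Rightarrow> 2)"
    by (rule bij_betw_byWitness[where f' = "\<lambda>z. z \<circ> inv \<sigma>"])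
      (auto simp: comp_assoc permutes_inv_o[OF \<sigma>])
  have "(\<Sum>y\<in>UNIV. (\<Prod>i\<in>UNIV. A i $ x (\<sigma> i) $ y i) * \<psi> $ y)
      = (\<Sum>z\<in>UNIV. (\<Prod>i\<in>UNIV. A (inv \<sigma> i) $ x i $ z i) * \<psi> $ (z \<circ> \<sigma>))" for x
  proof -
    have "(\<Sum>y\<in>UNIV. (\<Prod>i\<in>UNIV. A i $ x (\<sigma> i) $ y i) * \<psi> $ y)
      = (\<Sum>z\<in>UNIV. (\<Prod>i\<in>UNIV. A i $ x (\<sigma> i) $ (z \<circ> \<sigma>) i) * \<psi> $ (z \<circ> \<sigma>))"
      using sum.reindex_bij_betw[OF bij, of "\<lambda>y. (\<Prod>i\<in>UNIV. A i $ x (\<sigma> i) $ y i) * \<psi> $ y"] by simp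
    moreover have "(\<Prod>i\<in>UNIV. A i $ x (\<sigma> i) $ (z \<circ> \<sigma>) i) = (\<Prod>i\<in>UNIV. A (inv \<sigma> i) $ x i $ z i)" for z
      using prod.permute[OF \<sigma>, of "\<lambda>i. A (inv \<sigma> i) $ x i $ z i"] permutes_inverses(2)[OF \<sigma>]
      by (simp add: o_def)
    ultimately show ?thesis by simp
  qed
  then show ?thesis
    by (simp add: vec_eq_iff permute_factors_def tensor_op_def matrix_vector_mult_def)
qed

section \<open>Operators acting at a single site\<close>

definition site_op :: "'n::finite \<Rightarrow> complex ^ 2 ^ 2 \<Rightarrow> complex ^ ('n \<Rightarrow> 2) ^ ('n \<Rightarrow> 2)" where
  "site_op k C = tensor_op (\<lambda>i. if i = k then C else mat 1)"

text \<open>The identity factors away from \<open>k\<close> annihilate every column string that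
  differs from \<open>x\<close> off \<open>k\<close>, so of the full sum over strings only the two
  strings \<open>x(k := b)\<close> survive.\<close>

lemma site_op_nth:
  "(site_op k C *v \<psi>) $ x = (\<Sum>b\<in>UNIV. C $ x k $ b * \<psi> $ (x(k := b)))"
proof -
  have entry: "site_op k C $ x $ y = (if \<forall>i. i \<noteq> k \<longrightarrow> x i = y i then C $ x k $ y k else 0)" for y
  proof -
    have "site_op k C $ x $ y = C $ x k $ y k * (\<Prod>i\<in>UNIV - {k}. if x i = y i then 1 else 0)"
      by (simp add: site_op_def tensor_op_def prod.remove[of UNIV k] mat_def)
    then show ?thesis by auto
  qed
  have "(site_op k C *v \<psi>) $ x = (\<Sum>y\<in>UNIV. site_op k C $ x $ y * \<psi> $ y)"
    by (simp add: matrix_vector_mult_def)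
  also have "\<dots> = (\<Sum>y\<in>range (\<lambda>b. x(k := b)). site_op k C $ x $ y * \<psi> $ y)"
  proof (rule sum.mono_neutral_right)
    show "\<forall>y\<in>UNIV - range (\<lambda>b. x(k := b)). site_op k C $ x $ y * \<psi> $ y = 0"
    proof
      fix y assume y: "y \<in> UNIV - range (\<lambda>b. x(k := b))"
      then have "y \<noteq> x(k := y k)" by blast
      then obtain i where "y i \<noteq> (x(k := y k)) i" by blast
      then have "\<not> (\<forall>i. i \<noteq> k \<longrightarrow> x i = y i)" by (cases "i = k") auto
      then show "site_op k C $ x $ y * \<psi> $ y = 0" by (simp only: entry) simp
    qed
  qed auto
  also have "\<dots> = (\<Sum>b\<in>UNIV. C $ x k $ b * \<psi> $ (x(k := b)))"
    by (subst sum.reindex) (auto simp: entry inj_def fun_eq_iff)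
  finally show ?thesis .
qed

text \<open>A scalar matrix acts alike at every site. Hence shifting \<open>C\<close> by an
  eigenvalue preserves the property that its action on \<open>\<psi>\<close> does not depend on the
  site.\<close>

lemma site_op_diff_mat:
  "site_op k (C - mat \<mu>) *v \<psi> = site_op k C *v \<psi> - \<mu> *s \<psi>"
proof -
  have "(\<Sum>b\<in>UNIV. (if u = b then \<mu> else 0) * h b) = \<mu> * h u" for u :: 2 and h
    by (simp add: if_distrib[of "\<lambda>v. v * _"] cong: if_cong)
  then have *: "(\<Sum>b\<in>UNIV. mat \<mu> $ u $ b * h b) = \<mu> * h u" for u :: 2 and h
    by (simp add: mat_def)
  show ?thesis
    by (simp add: vec_eq_iff site_op_nth left_diff_distrib sum_subtractf *)
qed

text \<open>Two transpositions suffice: the first takes \<open>i\<close> to \<open>k\<close> and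
  \<open>j\<close> to some \<open>j'\<close> different from \<open>k\<close>; the second takes
  \<open>j'\<close> to \<open>l\<close> and leaves \<open>k\<close> alone.\<close>

lemma transitive_on_pairs:
  assumes "i \<noteq> j" "k \<noteq> l"
  obtains \<sigma> where "\<sigma> permutes UNIV" "\<sigma> i = k" "\<sigma> j = l"
proof -
  define j' where "j' = Transposition.transpose i k j"
  have "j' \<noteq> k" using assms by (auto simp: j'_def Transposition.transpose_def split: if_splits)
  then have "(Transposition.transpose j' l \<circ> Transposition.transpose i k) i = k" "(Transposition.transpose j' l \<circ> Transposition.transpose i k) j = l"
    using assms by (auto simp: j'_def)
  moreover have "(Transposition.transpose j' l \<circ> Transposition.transpose i k) permutes UNIV"
    by (intro permutes_compose permutes_swap_id) auto
  ultimately show ?thesis using that by blast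
qed

lemma permute_factors_site_op:
  assumes \<sigma>: "\<sigma> permutes UNIV"
  shows "permute_factors \<sigma> (site_op k C *v \<psi>) = site_op (\<sigma> k) C *v permute_factors \<sigma> \<psi>"
proof -
  have "inv \<sigma> i = k \<longleftrightarrow> i = \<sigma> k" for i
    using permutes_inv_eq[OF \<sigma>] by metis
  then have "(\<lambda>i. if i = k then C else mat 1) \<circ> inv \<sigma> = (\<lambda>i. if i = \<sigma> k then C else mat 1)"
    by (auto simp: fun_eq_iff)
  then show ?thesis
    by (simp add: site_op_def permute_factors_tensor_op[OF \<sigma>])
qed

text \<open>A permutation taking \<open>(i, j)\<close> to \<open>(k, l)\<close> carries the given
  equation to the desired one, since it fixes \<open>\<psi>\<close> and relabels the sites.\<close>

lemma site_op_all_pairs: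
  assumes "symmetric_state \<psi>" "i \<noteq> j" and eq: "site_op i C *v \<psi> = site_op j C *v \<psi>"
  shows "site_op k C *v \<psi> = site_op l C *v \<psi>"
proof (cases "k = l")
  case False
  then obtain \<sigma> where \<sigma>: "\<sigma> permutes UNIV" "\<sigma> i = k" "\<sigma> j = l"
    using transitive_on_pairs assms(2) by metis
  have "permute_factors \<sigma> (site_op i C *v \<psi>) = permute_factors \<sigma> (site_op j C *v \<psi>)"
    using eq by simp
  then show ?thesis
    using assms(1) \<sigma> by (simp add: permute_factors_site_op symmetric_state_def)
qed simp

section \<open>Invertible local operations, coordinates and SLOCC classes\<close>

lemma invertible_matrix_inv:
  assumes "invertible (A :: complex ^ 'm ^ 'm)"
  shows "A ** matrix_inv A = mat 1" "matrix_inv A ** A = mat 1" "invertible (matrix_inv A)"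
proof -
  show 1: "A ** matrix_inv A = mat 1" "matrix_inv A ** A = mat 1"
    using assms unfolding invertible_def matrix_inv_def by (metis (mono_tags, lifting) someI_ex)+
  then show "invertible (matrix_inv A)" unfolding invertible_def by blast
qed

lemma tensor_op_inverse:
  assumes "\<And>i. invertible (P i)"
  shows "tensor_op P *v (tensor_op (\<lambda>i. matrix_inv (P i)) *v \<psi>) = \<psi>"
    "tensor_op (\<lambda>i. matrix_inv (P i)) *v (tensor_op P *v \<psi>) = \<psi>"
  using assms by (simp_all add: tensor_op_mult_vec invertible_matrix_inv tensor_op_one)

text \<open>Using the same operator at every site commutes with all permutations of the factors.
  This makes a simultaneous change of basis compatible with symmetry.\<close>

lemma symmetric_state_uniform:
  assumes "symmetric_state \<psi>" "invertible P"
  shows "symmetric_state (tensor_op (\<lambda>_. P) *v \<psi>)"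
proof -
  have "tensor_op (\<lambda>_. P) *v \<psi> \<noteq> 0"
    using tensor_op_inverse(2)[of "\<lambda>_. P" \<psi>] assms
    by (auto simp: symmetric_state_def is_state_def)
  then show ?thesis
    using assms(1) by (simp add: symmetric_state_def is_state_def permute_factors_tensor_op o_def)
qed

lemma slocc_class_tensor_op:
  assumes "\<alpha> \<in> slocc_class \<beta>" and B: "\<And>i. invertible (B i)"
  shows "tensor_op B *v \<alpha> \<in> slocc_class \<beta>"
proof -
  obtain D where D: "\<And>i. invertible (D i)" "\<alpha> = tensor_op D *v \<beta>" and nz: "\<alpha> \<noteq> 0"
    using assms by (auto simp: slocc_class_def slocc_equivalent_def is_state_def)
  have "tensor_op B *v \<alpha> \<noteq> 0"
    using tensor_op_inverse(2)[of B \<alpha>] B nz by auto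
  moreover have "tensor_op B *v \<alpha> = tensor_op (\<lambda>i. B i ** D i) *v \<beta>"
    by (simp add: D tensor_op_mult_vec)
  ultimately show ?thesis
    using B D unfolding slocc_class_def slocc_equivalent_def is_state_def
    by (auto intro!: exI[of _ "\<lambda>i. B i ** D i"] invertible_mult)
qed

lemma ket_nth: "ket y $ x = (if x = y then 1 else 0)"
  by (auto simp: ket_def tensor_vec_def axis_def fun_eq_iff)

lemma tensor_op_ket_nth: "(tensor_op B *v ket x) $ y = (\<Prod>i\<in>UNIV. B i $ y i $ x i)"
proof -
  have "(\<Sum>z\<in>UNIV. M z * (if z = x then 1 else 0)) = M x" for M :: "_ \<Rightarrow> complex"
    by (simp add: if_distrib cong: if_cong)
  then show ?thesis
    by (simp add: matrix_vector_mult_def ket_nth tensor_op_def)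
qed

lemma site_op_diagonal_nth:
  "(site_op k (mat2 a 0 0 b) *v \<psi>) $ x = (if x k = 0 then a else b) * \<psi> $ x"
proof -
  have "x(k := x k) = x" by simp
  then show ?thesis
    using bit_cases[of "x k"] by (auto simp: site_op_nth sum_bit simp del: fun_upd_triv)
qed

lemma site_op_nilpotent_nth:
  "(site_op k (mat2 0 1 0 0) *v \<psi>) $ x = (if x k = 0 then \<psi> $ (x(k := 1)) else 0)"
  using bit_cases[of "x k"] by (auto simp: site_op_nth sum_bit)

lemma slocc_class_self: "is_state \<beta> \<Longrightarrow> \<beta> \<in> slocc_class \<beta>"
  unfolding slocc_class_def slocc_equivalent_def
  by (auto intro!: exI[of _ "\<lambda>_. mat 1"] simp: tensor_op_one invertible_mat_one)

lemma slocc_class_site_op: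
  assumes "\<alpha> \<in> slocc_class \<beta>" "invertible C"
  shows "site_op k C *v \<alpha> \<in> slocc_class \<beta>"
  unfolding site_op_def using assms by (intro slocc_class_tensor_op) (simp_all add: invertible_mat_one)

text \<open>The scalar is absorbed into a single tensor factor as a scalar matrix.\<close>

lemma slocc_class_scale:
  fixes \<alpha> :: "'n::finite qubits"
  assumes "\<alpha> \<in> slocc_class \<beta>" "c \<noteq> 0"
  shows "c *s \<alpha> \<in> slocc_class \<beta>"
proof -
  have "c *s \<alpha> = site_op k (mat2 c 0 0 c) *v \<alpha>" for k :: 'n
    by (simp add: vec_eq_iff site_op_diagonal_nth)
  then show ?thesis
    using slocc_class_site_op[OF assms(1)] assms(2) by (metis invertible_mat2 mult_zero_left diff_zero no_zero_divisors)
qed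

lemma is_state_nth: "\<psi> $ x \<noteq> 0 \<Longrightarrow> is_state \<psi>"
  by (auto simp: is_state_def)

section \<open>Standard members of the three classes\<close>

text \<open>For \<open>b = 1\<close>, the bit flip \<open>mat2 0 1 1 0\<close> at every site carries
  the all-zero ket to the all-one ket.\<close>

lemma separable_class_constant_ket: "ket (\<lambda>_::'n::finite. b) \<in> separable_class"
proof -
  have 0: "ket (\<lambda>_::'n. 0) \<in> separable_class"
    unfolding separable_class_def
    by (rule slocc_class_self, rule is_state_nth[of _ "\<lambda>_. 0"]) (simp add: ket_nth)
  have "(\<Prod>i\<in>UNIV. mat2 0 1 1 0 $ y i $ 0) = (if y = (\<lambda>_. 1) then 1 else 0)" for y :: "'n \<Rightarrow> 2"
  proof -
    have "mat2 0 1 1 0 $ b $ 0 = (if b = 1 then 1 else 0)" for b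
      using bit_cases[of b] by auto
    then show ?thesis by (auto simp: fun_eq_iff)
  qed
  then have "tensor_op (\<lambda>_::'n. mat2 0 1 1 0) *v ket (\<lambda>_. 0) = ket (\<lambda>_. 1)"
    by (simp add: vec_eq_iff tensor_op_ket_nth ket_nth)
  moreover have "tensor_op (\<lambda>_::'n. mat2 0 1 1 0) *v ket (\<lambda>_. 0) \<in> separable_class"
    using 0 unfolding separable_class_def
    by (intro slocc_class_tensor_op) (auto simp: invertible_mat2)
  ultimately show ?thesis
    using 0 bit_cases[of b] by auto
qed

text \<open>A diagonal operator at one site rescales the two terms of \<open>GHZ_state\<close>
  independently; the factors \<open>sqrt 2\<close> cancel the normalization.\<close>

lemma GHZ_class_combination:
  fixes a b :: complex
  assumes "a \<noteq> 0" "b \<noteq> 0"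
  shows "a *s ket (\<lambda>_. 0) + b *s ket (\<lambda>_::'n::finite. 1) \<in> GHZ_class"
proof -
  have "GHZ_state $ (\<lambda>_::'n. 0) \<noteq> 0"
    by (simp add: GHZ_state_def ket_nth fun_eq_iff)
  then have "GHZ_state \<in> (GHZ_class :: 'n qubits set)"
    unfolding GHZ_class_def by (intro slocc_class_self is_state_nth)
  moreover have "invertible (mat2 (a * complex_of_real (sqrt 2)) 0 0 (b * complex_of_real (sqrt 2)))"
    using assms by (simp add: invertible_mat2)
  ultimately have "site_op k (mat2 (a * complex_of_real (sqrt 2)) 0 0 (b * complex_of_real (sqrt 2))) *v GHZ_state
      \<in> GHZ_class" for k :: 'n
    unfolding GHZ_class_def by (rule slocc_class_site_op)
  moreover have "site_op k (mat2 (a * complex_of_real (sqrt 2)) 0 0 (b * complex_of_real (sqrt 2))) *v GHZ_state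
      = a *s ket (\<lambda>_. 0) + b *s ket (\<lambda>_. 1)" for k :: 'n
    by (auto simp: vec_eq_iff site_op_diagonal_nth GHZ_state_def ket_nth fun_eq_iff
        simp flip: of_real_mult)
  ultimately show ?thesis by metis
qed

text \<open>The shear \<open>mat2 1 c 0 1\<close> at every site fixes the all-zero ket and adds
  \<open>c\<close> times it to each of the \<open>N\<close> kets of weight one. Their total
  \<open>N * c\<close> is to equal \<open>a / b\<close>, which dictates \<open>c\<close>; the scalar
  \<open>b / s\<close> then replaces the normalization \<open>s\<close> by \<open>b\<close>.\<close>

lemma W_class_combination:
  fixes a b :: complex
  assumes "b \<noteq> 0"
  shows "a *s ket (\<lambda>_. 0) + b *s (\<Sum>k\<in>UNIV. ket (\<lambda>i. if i = k then 1 else 0)) \<in> (W_class :: 'n::finite qubits set)"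
proof -
  let ?e = "\<lambda>k i. if i = k then 1 else (0::2)"
  let ?S = "\<Sum>k\<in>UNIV. ket (?e k) :: 'n qubits"
  define N where "N = complex_of_nat CARD('n)"
  define s where "s = complex_of_real (1 / sqrt (real CARD('n)))"
  define c where "c = a / (b * N)"
  have nz: "N \<noteq> 0" "s \<noteq> 0" by (simp_all add: N_def s_def)
  have W: "W_state = s *s ?S" by (simp add: W_state_def s_def)
  have e_inj: "?e k = ?e l \<longleftrightarrow> k = l" for k l :: 'n
    by (auto simp: fun_eq_iff)
  have "W_state $ ?e k \<noteq> 0" for k :: 'n
    using nz by (simp add: W ket_nth e_inj)
  then have "W_state \<in> (W_class :: 'n qubits set)"
    unfolding W_class_def by (intro slocc_class_self is_state_nth)
  then have in_W: "(b / s) *s (tensor_op (\<lambda>_. mat2 1 c 0 1) *v W_state) \<in> (W_class :: 'n qubits set)"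
    unfolding W_class_def using assms nz
    by (intro slocc_class_scale slocc_class_tensor_op) (auto simp: invertible_mat2)
  have ket: "tensor_op (\<lambda>_. mat2 1 c 0 1) *v ket (?e k) = ket (?e k) + c *s ket (\<lambda>_. 0)" for k :: 'n
  proof -
    have "(\<Prod>i\<in>UNIV. mat2 1 c 0 1 $ y i $ ?e k i)
        = (if y = ?e k then 1 else 0) + c * (if y = (\<lambda>_. 0) then 1 else 0)" for y :: "'n \<Rightarrow> 2"
    proof -
      \<comment> \<open>Column 0 of the shear is the first basis vector, so every site other than
        \<open>k\<close> forces the bit 0.\<close>
      have m: "mat2 1 c 0 1 $ u $ 0 = (if u = 0 then 1 else 0)" for u
        using bit_cases[of u] by auto
      have "(\<Prod>i\<in>UNIV. mat2 1 c 0 1 $ y i $ ?e k i)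
          = mat2 1 c 0 1 $ y k $ 1 * (\<Prod>i\<in>UNIV - {k}. if y i = 0 then 1 else 0)"
        by (simp add: prod.remove[of UNIV k] m)
      moreover have "y = ?e k \<longleftrightarrow> y k = 1 \<and> (\<forall>i. i \<noteq> k \<longrightarrow> y i = 0)"
        "y = (\<lambda>_. 0) \<longleftrightarrow> y k = 0 \<and> (\<forall>i. i \<noteq> k \<longrightarrow> y i = 0)"
        by (auto simp: fun_eq_iff)
      ultimately show ?thesis
        using bit_cases[of "y k"] by auto
    qed
    then show ?thesis
      by (simp add: vec_eq_iff tensor_op_ket_nth ket_nth)
  qed
  have "tensor_op (\<lambda>_. mat2 1 c 0 1) *v ?S = (\<Sum>k\<in>UNIV. tensor_op (\<lambda>_. mat2 1 c 0 1) *v ket (?e k))"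
    by (rule vec.linear_sum[OF matrix_vector_mul_linear_gen])
  also have "\<dots> = ?S + (N * c) *s ket (\<lambda>_. 0)"
    by (simp add: ket sum.distrib vec_eq_iff N_def of_nat_index)
  finally have "(b / s) *s (tensor_op (\<lambda>_. mat2 1 c 0 1) *v W_state)
      = b *s (?S + (N * c) *s ket (\<lambda>_. 0))"
    using nz by (simp add: W vector_scalar_commute)
  also have "\<dots> = a *s ket (\<lambda>_. 0) + b *s ?S"
    using nz assms by (simp add: vec_eq_iff c_def algebra_simps)
  finally show ?thesis using in_W by simp
qed

section \<open>Classes determined by the support of a state\<close>

text \<open>Only the all-zero and the all-one coordinates can be nonzero: if both are, the state is
  of GHZ type, and if just one is, it is separable.\<close>

lemma constant_support_class:
  fixes \<psi> :: "'n::finite qubits"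
  assumes "is_state \<psi>" and supp: "\<And>x k l. \<psi> $ x \<noteq> 0 \<Longrightarrow> x k = x l"
  shows "\<psi> \<in> separable_class \<or> \<psi> \<in> GHZ_class"
proof -
  define a where "a = \<psi> $ (\<lambda>_. 0)"
  define b where "b = \<psi> $ (\<lambda>_. 1)"
  have \<psi>: "\<psi> = a *s ket (\<lambda>_. 0) + b *s ket (\<lambda>_. 1)"
  proof -
    have "\<psi> $ x = (a *s ket (\<lambda>_. 0) + b *s ket (\<lambda>_. 1)) $ x" for x
    proof (cases "\<psi> $ x = 0")
      case True
      then show ?thesis by (auto simp: a_def b_def ket_nth)
    next
      case False
      then obtain u where u: "x = (\<lambda>_. u)" using supp by metis
      have "(\<lambda>_::'n. 0::2) \<noteq> (\<lambda>_. 1)" by (simp add: fun_eq_iff)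
      then show ?thesis
        using u bit_cases[of u] by (auto simp: a_def b_def ket_nth)
    qed
    then show ?thesis by (simp add: vec_eq_iff)
  qed
  have "a \<noteq> 0 \<or> b \<noteq> 0"
    using assms(1) \<psi> by (auto simp: is_state_def)
  moreover have "a *s ket (\<lambda>_. 0) \<in> (separable_class :: 'n qubits set)" if "a \<noteq> 0"
    using separable_class_constant_ket that unfolding separable_class_def by (rule slocc_class_scale)
  moreover have "b *s ket (\<lambda>_. 1) \<in> (separable_class :: 'n qubits set)" if "b \<noteq> 0"
    using separable_class_constant_ket that unfolding separable_class_def by (rule slocc_class_scale)
  ultimately show ?thesis
    using \<psi> GHZ_class_combination[of a b] by (cases "a = 0"; cases "b = 0") auto
qed

text \<open>Symmetry under transpositions makes all weight-one coordinates equal to one number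
  \<open>b\<close>. The state is of W type if \<open>b\<close> is nonzero and a multiple of the
  all-zero ket otherwise.\<close>

lemma weight_le_one_class:
  fixes \<psi> :: "'n::finite qubits"
  assumes sym: "symmetric_state \<psi>"
    and supp: "\<And>x k l. k \<noteq> l \<Longrightarrow> x k = 1 \<Longrightarrow> x l = 1 \<Longrightarrow> \<psi> $ x = 0"
  shows "\<psi> \<in> separable_class \<or> \<psi> \<in> W_class"
proof -
  let ?e = "\<lambda>k i. if i = k then 1 else (0::2)"
  obtain k0 :: 'n where True by simp
  define a where "a = \<psi> $ (\<lambda>_. 0)"
  define b where "b = \<psi> $ ?e k0"
  have e: "\<psi> $ ?e k = b" for k
  proof -
    have "Transposition.transpose k k0 permutes UNIV" by (intro permutes_swap_id) auto
    then have "\<psi> $ ?e k = permute_factors (Transposition.transpose k k0) \<psi> $ ?e k"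
      using sym by (simp add: symmetric_state_def)
    also have "?e k \<circ> Transposition.transpose k k0 = ?e k0"
      by (auto simp: fun_eq_iff Transposition.transpose_def split: if_splits)
    then have "permute_factors (Transposition.transpose k k0) \<psi> $ ?e k = b"
      by (simp add: permute_factors_def b_def)
    finally show ?thesis .
  qed
  have \<psi>: "\<psi> = a *s ket (\<lambda>_. 0) + b *s (\<Sum>k\<in>UNIV. ket (?e k))"
  proof -
    have "\<psi> $ x = a * (if x = (\<lambda>_. 0) then 1 else 0) + b * (\<Sum>k\<in>UNIV. if x = ?e k then 1 else 0)" for x
    proof -
      \<comment> \<open>The bit 1 occurs nowhere, at exactly one site, or at two distinct
        sites.\<close>
      consider "x = (\<lambda>_. 0)" | l where "x = ?e l" | k l where "k \<noteq> l" "x k = 1" "x l = 1"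
        using bit_cases by (metis (full_types))
      then show ?thesis
      proof cases
        case 1
        have "(\<lambda>_. 0) \<noteq> ?e k" for k :: 'n by (auto simp: fun_eq_iff)
        then show ?thesis using 1 by (simp add: a_def)
      next
        case 2
        have "?e l = ?e k \<longleftrightarrow> l = k" "?e l \<noteq> (\<lambda>_. 0)" for k by (auto simp: fun_eq_iff)
        then show ?thesis using e[of l] 2 by simp
      next
        case 3
        then have "x \<noteq> (\<lambda>_. 0)" "x \<noteq> ?e m" for m by (metis zero_neq_one)+
        then show ?thesis using supp[OF 3] by simp
      qed
    qed
    then show ?thesis by (simp add: vec_eq_iff ket_nth)
  qed
  show ?thesis
  proof (cases "b = 0")
    case True
    then have "\<psi> = a *s ket (\<lambda>_. 0)" using \<psi> by simp
    moreover from this have "a \<noteq> 0"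
      using sym by (auto simp: symmetric_state_def is_state_def)
    ultimately show ?thesis
      using separable_class_constant_ket slocc_class_scale unfolding separable_class_def by metis
  next
    case False
    then show ?thesis using \<psi> W_class_combination by metis
  qed
qed

section \<open>States on which a nonscalar matrix acts alike at every site\<close>

lemma site_invariant_class:
  fixes \<psi> :: "'n::finite qubits"
  assumes sym: "symmetric_state \<psi>" and nonscalar: "\<And>c. C \<noteq> mat c"
    and eq: "\<And>k l. site_op k C *v \<psi> = site_op l C *v \<psi>"
  shows "\<psi> \<in> separable_class \<or> \<psi> \<in> W_class \<or> \<psi> \<in> GHZ_class"
proof -
  obtain \<mu> P J where P: "invertible P" and PJ: "(C - mat \<mu>) ** P = P ** J"
    and J: "(\<exists>t. t \<noteq> 0 \<and> J = mat2 t 0 0 0) \<or> J = mat2 0 1 0 0"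
    using nonscalar_normal_form[OF nonscalar] .
  define \<psi>' where "\<psi>' = tensor_op (\<lambda>_. matrix_inv P) *v \<psi>"
  have \<psi>: "\<psi> = tensor_op (\<lambda>_. P) *v \<psi>'"
    using tensor_op_inverse(1)[of "\<lambda>_::'n. P"] P by (simp add: \<psi>'_def)
  have sym': "symmetric_state \<psi>'"
    using symmetric_state_uniform[OF sym] P by (simp add: \<psi>'_def invertible_matrix_inv)
  have "tensor_op (\<lambda>_. P) *v (site_op k J *v \<psi>') = site_op k (C - mat \<mu>) *v \<psi>" for k
  proof -
    \<comment> \<open>At site \<open>k\<close> this is the intertwining relation \<open>PJ\<close>;
      at every other site both sides are \<open>P\<close>.\<close>
    have "(\<lambda>i. P ** (if i = k then J else mat 1)) = (\<lambda>i. (if i = k then C - mat \<mu> else mat 1) ** P)"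
      by (auto simp: PJ)
    then show ?thesis
      by (simp add: \<psi> site_op_def tensor_op_mult_vec)
  qed
  then have "tensor_op (\<lambda>_. P) *v (site_op k J *v \<psi>') = tensor_op (\<lambda>_. P) *v (site_op l J *v \<psi>')" for k l
    using eq by (simp add: site_op_diff_mat)
  then have J_eq: "site_op k J *v \<psi>' = site_op l J *v \<psi>'" for k l
    using tensor_op_inverse(2)[of "\<lambda>_::'n. P"] P by metis
  have "\<psi>' \<in> separable_class \<or> \<psi>' \<in> W_class \<or> \<psi>' \<in> GHZ_class"
    using J
  proof (elim disjE exE conjE)
    fix t assume t: "t \<noteq> 0" "J = mat2 t 0 0 0"
    have "x k = x l" if "\<psi>' $ x \<noteq> 0" for x k l
    proof -
      \<comment> \<open>\<open>J\<close> multiplies the coordinate at \<open>x\<close> by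
        \<open>t\<close> or 0 according to the bit at its site, so a nonzero coordinate forces the
        bits at \<open>k\<close> and \<open>l\<close> to agree.\<close>
      have "(if x k = 0 then t else 0) * \<psi>' $ x = (if x l = 0 then t else 0) * \<psi>' $ x"
        using J_eq[of k l] t site_op_diagonal_nth by metis
      then show ?thesis
        using that t bit_cases[of "x k"] bit_cases[of "x l"] by (auto split: if_splits)
    qed
    then show ?thesis
      using constant_support_class sym' by (auto simp: symmetric_state_def)
  next
    assume J: "J = mat2 0 1 0 0"
    have "\<psi>' $ x = 0" if "k \<noteq> l" "x k = 1" "x l = 1" for x k l
    proof -
      \<comment> \<open>Compare coordinates at \<open>x(k := 0)\<close>: lowering at
        \<open>k\<close> returns \<open>\<psi>' $ x\<close>, while lowering at \<open>l\<close>
        returns 0 because bit \<open>l\<close> is 1.\<close>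
      have "x(k := 1) = x" using that by auto
      then show ?thesis
        using arg_cong[OF J_eq[of k l], of "\<lambda>v. v $ (x(k := 0))"] that
        by (simp add: J site_op_nilpotent_nth)
    qed
    then show ?thesis
      using weight_le_one_class[OF sym'] by blast
  qed
  then show ?thesis
    unfolding \<psi> separable_class_def W_class_def GHZ_class_def
    using slocc_class_tensor_op[of \<psi>' _ "\<lambda>_. P"] P by blast
qed

section \<open>Swapping two factors, and the theorem\<close>

lemma swapped_sites_eq:
  fixes \<psi> :: "'n::finite qubits"
  assumes sym: "symmetric_state \<psi>" "symmetric_state (tensor_op A *v \<psi>)"
    and inv: "\<And>i. invertible (A i)" and "i \<noteq> j"
  shows "site_op i (matrix_inv (A j) ** A i) *v \<psi> = site_op j (matrix_inv (A j) ** A i) *v \<psi>"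
proof -
  let ?\<tau> = "Transposition.transpose i j"
  \<comment> \<open>\<open>M\<close> inverts \<open>A m\<close> at every site except
    \<open>i\<close>, where it uses the inverse of \<open>A j\<close>. Applied to the original
    operators it leaves \<open>C\<close> at \<open>i\<close> and identities elsewhere; applied to
    the swapped ones it leaves \<open>C\<close> at \<open>j\<close>.\<close>
  define M where "M = (\<lambda>m. matrix_inv (A (if m = i then j else m)))"
  have "?\<tau> permutes UNIV" by (intro permutes_swap_id) auto
  then have "tensor_op A *v \<psi> = tensor_op (A \<circ> ?\<tau>) *v \<psi>"
    using sym permute_factors_tensor_op[of ?\<tau> A \<psi>]
    by (simp add: symmetric_state_def)
  then have "tensor_op (\<lambda>m. M m ** A m) *v \<psi> = tensor_op (\<lambda>m. M m ** A (?\<tau> m)) *v \<psi>"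
    by (metis (no_types, lifting) tensor_op_mult_vec comp_apply ext)
  moreover have "(\<lambda>m. M m ** A m) = (\<lambda>m. if m = i then matrix_inv (A j) ** A i else mat 1)"
    using inv by (auto simp: M_def invertible_matrix_inv)
  moreover have "(\<lambda>m. M m ** A (?\<tau> m)) = (\<lambda>m. if m = j then matrix_inv (A j) ** A i else mat 1)"
    using inv \<open>i \<noteq> j\<close> by (auto simp: M_def invertible_matrix_inv Transposition.transpose_def)
  ultimately show ?thesis
    by (simp add: site_op_def)
qed

text \<open>Multiplying back by \<open>B\<close> exhibits \<open>A\<close> as \<open>c\<close> times
  \<open>B\<close>, and \<open>c = 0\<close> would make \<open>A\<close> singular. By
  contraposition, nonproportional operators have a nonscalar quotient.\<close>

lemma proportional_if_scalar_quotient: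
  assumes "invertible A" "invertible B" "matrix_inv B ** A = mat c"
  shows "proportional A B"
proof -
  have "A = B ** (matrix_inv B ** A)"
    using assms(1,2) by (simp add: matrix_mul_assoc invertible_matrix_inv)
  then have "A = B ** mat c" using assms(3) by simp
  then have eq: "A = (\<chi> r s. c * B $ r $ s)"
    by (simp add: vec_eq_iff all_bit matrix_matrix_mult_def sum_bit mat_def)
  have "c \<noteq> 0"
  proof
    assume "c = 0"
    then have "A = 0" using eq by (simp add: vec_eq_iff)
    then show False using assms(1) by (simp add: invertible_det_nz det_2)
  qed
  then show ?thesis using eq unfolding proportional_def by blast
qed

theorem mainTheorem2:
  fixes \<psi> \<phi> :: "'n::finite qubits"
    and A :: "'n \<Rightarrow> complex ^ 2 ^ 2"
  assumes "CARD('n) \<ge> 2"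
    and "symmetric_state \<psi>" and "symmetric_state \<phi>"
    and "\<forall>i. invertible (A i)"
    and "\<phi> = tensor_op A *v \<psi>"
    and "\<exists>i j. \<not> proportional (A i) (A j)"
  shows "(\<psi> \<in> separable_class \<and> \<phi> \<in> separable_class) \<or>
         (\<psi> \<in> W_class \<and> \<phi> \<in> W_class) \<or>
         (\<psi> \<in> GHZ_class \<and> \<phi> \<in> GHZ_class)"
proof -
  obtain i j where ij: "\<not> proportional (A i) (A j)" using assms(6) by blast
  have "proportional (A i) (A i)"
    unfolding proportional_def by (rule exI[of _ 1]) (simp add: vec_eq_iff)
  then have "i \<noteq> j" using ij by auto
  define C where "C = matrix_inv (A j) ** A i"
  have "C \<noteq> mat c" for c
    using ij proportional_if_scalar_quotient assms(4) unfolding C_def by blast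
  moreover have "site_op k C *v \<psi> = site_op l C *v \<psi>" for k l
    using site_op_all_pairs[OF assms(2) \<open>i \<noteq> j\<close>] swapped_sites_eq[OF _ _ _ \<open>i \<noteq> j\<close>] assms
    unfolding C_def by blast
  ultimately have "\<psi> \<in> separable_class \<or> \<psi> \<in> W_class \<or> \<psi> \<in> GHZ_class"
    using site_invariant_class[OF assms(2)] by blast
  \<comment> \<open>Classes are closed under invertible local operations, so \<open>\<phi>\<close>
    shares whichever class contains \<open>\<psi>\<close>.\<close>
  moreover have "\<phi> \<in> slocc_class \<beta>" if "\<psi> \<in> slocc_class \<beta>" for \<beta>
    using slocc_class_tensor_op[OF that] assms by simp
  ultimately show ?thesis
    unfolding separable_class_def W_class_def GHZ_class_def by blast
qed

end
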